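(* As an identity of formal power series in $q$ with coefficients polynomial in $t$, \[ \sum_{n\geq0}\frac{q^{n(n+1)}\,(-t q;q^2)_n}{(q^2;q^2)_{n}\,(t q;q^2)_{n+1}}\;=\;\frac{(-q^2;q^2)_\infty}{(t q;q^2)_\infty}. \]
   Context: For a monomial $a$ (possibly involving $t$) and $k\ge 1$, $(a;q)_k=(1-a)(1-aq)\cdots(1-aq^{k-1})$, $(a;q)_0=1$, and $(a;q)_\infty=\prod_{j\ge 0}(1-aq^j)$; the same notation is used with $q$ replaced by $q^2$. *)

theory Defs
  imports "HOL-Analysis.Infinite_Products" "HOL-Computational_Algebra.Formal_Power_Series"
    "HOL-Computational_Algebra.Polynomial"
begin

definition qpoch :: "'a::comm_ring_1 \<Rightarrow> 'a \<Rightarrow> nat \<Rightarrow> 'a" where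
  "qpoch a q k = (\<Prod>j<k. 1 - a * q ^ j)"

definition qpoch_inf :: "'a::{t2_space, comm_ring_1} \<Rightarrow> 'a \<Rightarrow> 'a" where
  "qpoch_inf a q = (\<Prod>j. 1 - a * q ^ j)"

text \<open>
  The library's inverse and division on formal power series require an inverse on the
  coefficients, which is not available for polynomial coefficients. A series with constant
  coefficient \<open>1\<close> is nevertheless a unit over any commutative ring, and
  \<open>fps_right_inverse g 1\<close> is then its inverse. The quotient below is only meaningful for
  such denominators.
\<close>

definition fps_quot :: "'a::comm_ring_1 fps \<Rightarrow> 'a fps \<Rightarrow> 'a fps" where
  "fps_quot f g = f * fps_right_inverse g 1"

lemma fps_quot_mult:
  assumes "fps_nth g 0 = 1"
  shows "fps_quot f g * g = f"
proof -
  have "g * fps_right_inverse g 1 = 1"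
    by (rule fps_right_inverse) (use assms in simp)
  then show ?thesis
    unfolding fps_quot_def by (metis mult.assoc mult.commute mult.right_neutral)
qed

lemma fps_quot_unique:
  assumes "fps_nth g 0 = 1" "h * g = f"
  shows "h = fps_quot f g"
proof -
  have "g * fps_right_inverse g 1 = 1"
    by (rule fps_right_inverse) (use assms in simp)
  then show ?thesis
    by (simp add: fps_quot_def mult.assoc flip: assms(2))
qed

lemma fps_nth_qpoch_0:
  assumes "fps_nth a 0 = 0"
  shows "fps_nth (qpoch a q k) 0 = 1"
  unfolding qpoch_def by (induction k) (simp_all add: assms)

text \<open>
  Convergence is with respect to the library's topology on formal power series, in which a
  sequence converges iff each coefficient is eventually constant.
\<close>

lemma
  fixes a q :: "'a::comm_ring_1 fps"
  assumes a: "fps_nth a 0 = 0" and q: "fps_nth q 0 = 0"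
  shows has_prod_qpoch_inf: "(\<lambda>j. 1 - a * q ^ j) has_prod qpoch_inf a q"
    and fps_nth_qpoch_inf_0: "fps_nth (qpoch_inf a q) 0 = 1"
proof -
  define P where "P = (\<lambda>n. \<Prod>j\<le>n. 1 - a * q ^ j)"
  define L where "L = Abs_fps (\<lambda>n. fps_nth (P n) n)"
  have q': "q = fps_X * fps_shift 1 q"
    by (rule fps_ext) (use q in simp)
  have step: "fps_nth (P (Suc m)) n = fps_nth (P m) n" if "n \<le> m" for m n
  proof -
    have "q ^ Suc m = fps_X ^ Suc m * fps_shift 1 q ^ Suc m"
      by (subst q') (rule power_mult_distrib)
    then have "P (Suc m) = P m - fps_X ^ Suc m * (P m * a * fps_shift 1 q ^ Suc m)"
      unfolding P_def prod.atMost_Suc by (simp only: algebra_simps mult_1_left mult_1_right)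
    then show ?thesis
      using that by (simp only: fps_sub_nth fps_X_power_mult_nth) simp
  qed
  have "fps_nth (P m) n = fps_nth L n" if "n \<le> m" for m n
    using that by (induction m rule: dec_induct) (auto simp: L_def step)
  then have lim: "P \<longlonglongrightarrow> L"
    unfolding tendsto_fps_iff eventually_sequentially by blast
  have L0: "fps_nth L 0 = 1"
    by (simp add: L_def P_def a)
  then have "L \<noteq> 0" by auto
  with lim have L: "(\<lambda>j. 1 - a * q ^ j) has_prod L"
    by (simp add: has_prod_def raw_has_prod_def P_def)
  have eq: "qpoch_inf a q = L"
    unfolding qpoch_inf_def prodinf_def
  proof (rule the_equality)
    fix p assume p: "(\<lambda>j. 1 - a * q ^ j) has_prod p"
    have "1 - a * q ^ j \<noteq> 0" for j
    proof
      assume "1 - a * q ^ j = 0"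
      then have "fps_nth (1 - a * q ^ j) 0 = 0" by simp
      then show False using a by simp
    qed
    with p have "P \<longlonglongrightarrow> p"
      by (auto simp: has_prod_def raw_has_prod_def P_def)
    with lim show "p = L" by (rule LIMSEQ_unique[symmetric])
  qed (fact L)
  show "(\<lambda>j. 1 - a * q ^ j) has_prod qpoch_inf a q" by (simp add: eq L)
  show "fps_nth (qpoch_inf a q) 0 = 1" by (simp add: eq L0)
qed

end

theory Submission
  imports Defs
begin

text \<open>
  With \<open>Q = q\<^sup>2\<close> and \<open>x = t q\<close>, let \<open>F(x)\<close> be the left-hand side. Telescoping gives
  \<open>(1 - x) F(x) = F(x Q)\<close>, hence \<open>(x; Q)\<^sub>\<infinity> F(x) = F(0)\<close>. A second telescoping gives
  \<open>F(-Q) = 1\<close>, so \<open>F(0) = (-Q; Q)\<^sub>\<infinity>\<close>. To avoid interchanging limits, both steps are carried out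
  on the \<open>N\<close>-th partial sum, modulo \<open>q\<^sup>N\<close>.
\<close>

section \<open>Quotients and congruences of formal power series\<close>

lemma fps_quot_cancel:
  assumes "fps_nth g 0 = 1" "fps_nth h 0 = 1"
  shows "fps_quot (f * h) (g * h) = fps_quot f g"
  using fps_quot_mult[OF assms(1), of f] assms
  by (intro fps_quot_unique[symmetric]) (simp_all flip: mult.assoc)

lemma fps_quot_mult_left: "c * fps_quot f g = fps_quot (c * f) g"
  by (simp add: fps_quot_def mult.assoc)

lemma fps_quot_add: "fps_quot f g + fps_quot f' g = fps_quot (f + f') g"
  by (simp add: fps_quot_def algebra_simps)

lemma fps_quot_diff: "fps_quot f g - fps_quot f' g = fps_quot (f - f') g"
  by (simp add: fps_quot_def algebra_simps)

lemma fps_quot_minus: "fps_quot (- f) g = - fps_quot f g"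
  by (simp add: fps_quot_def)

text \<open>Congruence modulo \<open>d\<close> is expressed as divisibility of a difference.
  Compatibility with products is what carries congruences through Pochhammer products and
  quotients.\<close>

lemma dvd_diff_mult:
  fixes d :: "'a::comm_ring_1"
  assumes "d dvd a - a'" "d dvd b - b'"
  shows "d dvd a * b - a' * b'"
proof -
  have "a * b - a' * b' = (a - a') * b + a' * (b - b')"
    by (simp add: algebra_simps)
  then show ?thesis using assms by simp
qed

text \<open>The series \<open>g\<close> is a unit with inverse \<open>fps_quot 1 g\<close>.\<close>

lemma dvd_mult_unit_cancel:
  fixes d f g :: "'a::comm_ring_1 fps"
  assumes "fps_nth g 0 = 1" "d dvd f * g"
  shows "d dvd f"
proof -
  have "f = f * g * fps_quot 1 g"
    using fps_quot_mult[OF assms(1), of 1] by (simp add: mult.assoc mult.commute[of g])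
  then show ?thesis using assms(2) by (metis dvd_mult2)
qed

text \<open>Multiplying by the unit \<open>g * g'\<close> clears both denominators and leaves
  \<open>f * g' - f' * g\<close>, to which the product rule applies.\<close>

lemma dvd_diff_fps_quot:
  assumes "fps_nth g 0 = 1" "fps_nth g' 0 = 1" "d dvd f - f'" "d dvd g - g'"
  shows "d dvd fps_quot f g - fps_quot f' g'"
proof (rule dvd_mult_unit_cancel)
  show "fps_nth (g * g') 0 = 1" using assms by simp
  have "(fps_quot f g - fps_quot f' g') * (g * g')
      = fps_quot f g * g * g' - fps_quot f' g' * g' * g"
    by (simp add: algebra_simps)
  also have "\<dots> = f * g' - f' * g"
    by (simp only: fps_quot_mult assms)
  finally have *: "(fps_quot f g - fps_quot f' g') * (g * g') = f * g' - f' * g" .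
  have "d dvd g' - g" using assms(4) dvd_minus_iff[of d "g - g'"] by simp
  with assms(3) show "d dvd (fps_quot f g - fps_quot f' g') * (g * g')"
    unfolding * by (rule dvd_diff_mult)
qed

lemma fps_X_power_dvdI:
  fixes f :: "'a::comm_ring_1 fps"
  assumes "\<And>i. i < n \<Longrightarrow> fps_nth f i = 0"
  shows "fps_X ^ n dvd f"
proof
  show "f = fps_X ^ n * fps_shift n f"
    by (rule fps_ext) (simp add: fps_X_power_mult_nth assms)
qed

lemma fps_X_power_dvd_nth:
  fixes f :: "'a::comm_ring_1 fps"
  assumes "fps_X ^ n dvd f" "i < n"
  shows "fps_nth f i = 0"
  using assms by (auto simp: dvd_def fps_X_power_mult_nth)

lemma fps_X_power_dvd_power:
  fixes q :: "'a::comm_ring_1 fps"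
  assumes "fps_nth q 0 = 0"
  shows "fps_X ^ n dvd q ^ n"
proof -
  have "fps_X ^ 1 dvd q" by (rule fps_X_power_dvdI) (use assms in simp)
  then show ?thesis by (simp add: dvd_power_same)
qed

text \<open>Coefficient \<open>i\<close> agrees with that of the limit as soon as
  \<open>n > i\<close>.\<close>

lemma tendsto_fps_dvdI:
  fixes f :: "nat \<Rightarrow> 'a::comm_ring_1 fps"
  assumes "\<And>n. fps_X ^ n dvd f n - l"
  shows "f \<longlonglongrightarrow> l"
  unfolding tendsto_fps_iff
proof
  fix i
  show "\<forall>\<^sub>F n in sequentially. fps_nth (f n) i = fps_nth l i"
    using eventually_gt_at_top[of i]
    by eventually_elim (use fps_X_power_dvd_nth[OF assms] in fastforce)
qed

section \<open>Finite and infinite Pochhammer products\<close>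

lemma qpoch_0 [simp]: "qpoch a q 0 = 1"
  by (simp add: qpoch_def)

lemma qpoch_Suc: "qpoch a q (Suc n) = qpoch a q n * (1 - a * q ^ n)"
  by (simp add: qpoch_def)

lemma qpoch_Suc_shift: "qpoch a q (Suc n) = (1 - a) * qpoch (a * q) q n"
  unfolding qpoch_def prod.lessThan_Suc_shift by (simp add: mult.assoc)

lemma qpoch_dvd_diff:
  assumes "d dvd a - b"
  shows "d dvd qpoch a q n - qpoch b q n"
proof (induction n)
  case (Suc n)
  have "(1 - a * q ^ n) - (1 - b * q ^ n) = - ((a - b) * q ^ n)"
    by (simp add: algebra_simps)
  with assms have "d dvd (1 - a * q ^ n) - (1 - b * q ^ n)" by simp
  with Suc show ?case by (simp only: qpoch_Suc dvd_diff_mult)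
qed simp

text \<open>Each factor with index \<open>m \<ge> n\<close> alters the product by a multiple of
  \<open>q ^ m\<close>, so the coefficients below \<open>n\<close> are already final after
  \<open>n\<close> factors.\<close>

lemma qpoch_inf_dvd_diff:
  fixes a q :: "'a::comm_ring_1 fps"
  assumes a: "fps_nth a 0 = 0" and q: "fps_nth q 0 = 0"
  shows "fps_X ^ n dvd qpoch_inf a q - qpoch a q n"
proof (rule fps_X_power_dvdI)
  fix i assume i: "i < n"
  have stable: "fps_nth (qpoch a q m) i = fps_nth (qpoch a q n) i" if "n \<le> m" for m
    using that
  proof (induction m rule: dec_induct)
    case (step m)
    have "fps_X ^ Suc i dvd q ^ m"
      using fps_X_power_dvd_power[OF q, of m] le_imp_power_dvd[of "Suc i" m fps_X] i step.hyps
      by (meson Suc_leI dvd_trans less_le_trans)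
    then have "fps_X ^ Suc i dvd qpoch a q m * a * q ^ m" by simp
    then have "fps_nth (qpoch a q m * a * q ^ m) i = 0"
      by (rule fps_X_power_dvd_nth) simp
    moreover have "qpoch a q (Suc m) = qpoch a q m - qpoch a q m * a * q ^ m"
      by (simp add: qpoch_Suc algebra_simps)
    ultimately show ?case using step.IH by simp
  qed simp
  \<comment> \<open>Since no factor vanishes, the clause of \<open>has_prod\<close> for zero factors
    is excluded, and plain convergence of the partial products remains.\<close>
  have "1 - a * q ^ j \<noteq> 0" for j
  proof
    assume "1 - a * q ^ j = 0"
    then have "fps_nth (1 - a * q ^ j) 0 = 0" by simp
    then show False using a by simp
  qed
  with has_prod_qpoch_inf[OF a q] have "(\<lambda>m. qpoch a q (Suc m)) \<longlonglongrightarrow> qpoch_inf a q"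
    by (auto simp: has_prod_def raw_has_prod_def qpoch_def lessThan_Suc_atMost)
  then obtain M where M: "\<And>m. m \<ge> M \<Longrightarrow> fps_nth (qpoch a q (Suc m)) i = fps_nth (qpoch_inf a q) i"
    unfolding tendsto_fps_iff eventually_sequentially by blast
  from M[of "max n M"] stable[of "Suc (max n M)"]
  show "fps_nth (qpoch_inf a q - qpoch a q n) i = 0" by simp
qed

section \<open>The functional equation between \<open>x\<close> and
  \<open>x * q\<^sup>2\<close>\<close>

text \<open>A free variable \<open>x\<close> replaces \<open>t * q\<close>, so that it can be
  specialised to \<open>x * q\<^sup>2\<close>, to \<open>0\<close> and to
  \<open>- (q\<^sup>2)\<close>.\<close>

definition gauss_term :: "'a::comm_ring_1 fps \<Rightarrow> 'a fps \<Rightarrow> nat \<Rightarrow> 'a fps" where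
  "gauss_term q x n = fps_quot (q ^ (n * (n + 1)) * qpoch (- x) (q\<^sup>2) n)
     (qpoch (q\<^sup>2) (q\<^sup>2) n * qpoch x (q\<^sup>2) (n + 1))"

text \<open>This is the exact finite form of (1 - x) F(x) = F(xQ). The right-hand side is the
  truncation error, small because of its high power of \<open>q\<close>.\<close>

lemma gauss_term_sum_shift:
  fixes q x :: "'a::comm_ring_1 fps"
  assumes q: "fps_nth q 0 = 0" and x: "fps_nth x 0 = 0"
  shows "(1 - x) * (\<Sum>n\<le>N. gauss_term q x n) - (\<Sum>n\<le>N. gauss_term q (x * q\<^sup>2) n)
    = - fps_quot (q ^ ((N + 1) * (N + 2)) * x * qpoch (- (x * q\<^sup>2)) (q\<^sup>2) N)
        (qpoch (q\<^sup>2) (q\<^sup>2) N * qpoch (x * q\<^sup>2) (q\<^sup>2) (N + 1))"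
    (is "?lhs N = - ?U N")
proof -
  have c0 [simp]: "fps_nth (qpoch (q\<^sup>2) (q\<^sup>2) n) 0 = 1" "fps_nth (qpoch (x * q\<^sup>2) (q\<^sup>2) n) 0 = 1"
      "fps_nth (qpoch x (q\<^sup>2) n) 0 = 1" for n
    by (simp_all add: fps_nth_qpoch_0 q x power2_eq_square)
  \<comment> \<open>The factor \<open>1 - x\<close> cancels the first factor of
    \<open>qpoch x\<close>, so both sums acquire denominators based on
    \<open>x * q\<^sup>2\<close>.\<close>
  have first: "(1 - x) * gauss_term q x n
      = fps_quot (q ^ (n * (n + 1)) * qpoch (- x) (q\<^sup>2) n)
          (qpoch (q\<^sup>2) (q\<^sup>2) n * qpoch (x * q\<^sup>2) (q\<^sup>2) n)" for n
  proof -
    let ?f = "q ^ (n * (n + 1)) * qpoch (- x) (q\<^sup>2) n"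
    have "(1 - x) * gauss_term q x n
        = fps_quot (?f * (1 - x)) (qpoch (q\<^sup>2) (q\<^sup>2) n * qpoch (x * q\<^sup>2) (q\<^sup>2) n * (1 - x))"
      unfolding gauss_term_def fps_quot_mult_left by (simp add: qpoch_Suc_shift mult_ac)
    also have "\<dots> = fps_quot ?f (qpoch (q\<^sup>2) (q\<^sup>2) n * qpoch (x * q\<^sup>2) (q\<^sup>2) n)"
      by (rule fps_quot_cancel) (simp_all add: x)
    finally show ?thesis .
  qed
  show ?thesis
  proof (induction N)
    case 0
    have "fps_quot (1 * (1 - x * q\<^sup>2)) (1 * (1 - x * q\<^sup>2)) = fps_quot 1 (1 :: 'a fps)"
      by (rule fps_quot_cancel) (simp_all add: x)
    then have "(1 - x) * gauss_term q x 0 = fps_quot (1 - x * q\<^sup>2) (1 - x * q\<^sup>2)"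
      by (simp add: first)
    then show ?case
      by (simp add: gauss_term_def qpoch_Suc fps_quot_diff)
         (simp add: fps_quot_def power2_eq_square mult_ac)
  next
    case (Suc N)
    \<comment> \<open>All four quotients in the induction step are brought over the common
      denominator \<open>D\<close>. Here \<open>p\<close> is the power of \<open>q\<close> in
      summand \<open>N + 1\<close>, and passing to the next index multiplies it by
      \<open>q\<^sup>2 * r\<close>.\<close>
    define a where "a = qpoch (- (x * q\<^sup>2)) (q\<^sup>2) N"
    define p where "p = q ^ ((N + 1) * (N + 2))"
    define r where "r = (q\<^sup>2) ^ (N + 1)"
    define D where "D = qpoch (q\<^sup>2) (q\<^sup>2) (N + 1) * qpoch (x * q\<^sup>2) (q\<^sup>2) (N + 2)"
    have r: "q\<^sup>2 * (q\<^sup>2) ^ N = r" "x * q\<^sup>2 * (q\<^sup>2) ^ N = x * r"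
        "x * q\<^sup>2 * (q\<^sup>2) ^ (N + 1) = x * (q\<^sup>2 * r)" "- (x * q\<^sup>2) * (q\<^sup>2) ^ N = - (x * r)"
      by (simp_all add: r_def mult.assoc)
    have p: "q ^ (Suc N * (Suc N + 1)) = p" "q ^ ((Suc N + 1) * (Suc N + 2)) = p * (q\<^sup>2 * r)"
      unfolding p_def r_def power_mult[symmetric] power_add[symmetric]
      by (rule arg_cong[where f = "power q"], simp)+
    have r0: "fps_nth r 0 = 0" by (simp add: r_def q power2_eq_square)
    have 1: "(1 - x) * gauss_term q x (Suc N) = fps_quot (p * ((1 + x) * a) * (1 - x * (q\<^sup>2 * r))) D"
    proof -
      have "(1 - x) * gauss_term q x (Suc N) = fps_quot (p * ((1 + x) * a))
          (qpoch (q\<^sup>2) (q\<^sup>2) (Suc N) * qpoch (x * q\<^sup>2) (q\<^sup>2) (Suc N))"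
        unfolding first p by (simp add: qpoch_Suc_shift[of "- x"] a_def)
      also have "\<dots> = fps_quot (p * ((1 + x) * a) * (1 - x * (q\<^sup>2 * r)))
          (qpoch (q\<^sup>2) (q\<^sup>2) (Suc N) * qpoch (x * q\<^sup>2) (q\<^sup>2) (Suc N) * (1 - x * (q\<^sup>2 * r)))"
        by (rule fps_quot_cancel[symmetric]) (simp_all add: x)
      also have "qpoch (q\<^sup>2) (q\<^sup>2) (Suc N) * qpoch (x * q\<^sup>2) (q\<^sup>2) (Suc N) * (1 - x * (q\<^sup>2 * r)) = D"
        using r(3) by (simp add: D_def qpoch_Suc[of _ _ "Suc N"] mult.assoc)
      finally show ?thesis .
    qed
    have 2: "gauss_term q (x * q\<^sup>2) (Suc N) = fps_quot (p * a * (1 + x * r)) D"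
      unfolding gauss_term_def p D_def qpoch_Suc[of "- (x * q\<^sup>2)"] r a_def
      by (simp add: mult.assoc)
    have 3: "?U N = fps_quot (p * x * a * ((1 - r) * (1 - x * (q\<^sup>2 * r)))) D"
    proof -
      have "D = qpoch (q\<^sup>2) (q\<^sup>2) N * qpoch (x * q\<^sup>2) (q\<^sup>2) (N + 1) * ((1 - r) * (1 - x * (q\<^sup>2 * r)))"
        using r(1,3) by (simp add: D_def qpoch_Suc[of "q\<^sup>2"] qpoch_Suc[of _ _ "Suc N"] mult_ac)
      then show ?thesis
        by (simp only: flip: p_def a_def) (rule fps_quot_cancel[symmetric], simp_all add: x r0)
    qed
    have 4: "?U (Suc N) = fps_quot (p * (q\<^sup>2 * r) * x * (a * (1 + x * r))) D"
      unfolding p D_def qpoch_Suc[of "- (x * q\<^sup>2)"] r a_def by (simp add: mult.assoc)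
    have "?lhs (Suc N) = ?lhs N + (1 - x) * gauss_term q x (Suc N) - gauss_term q (x * q\<^sup>2) (Suc N)"
      by (simp add: algebra_simps)
    also have "\<dots> = (1 - x) * gauss_term q x (Suc N) - gauss_term q (x * q\<^sup>2) (Suc N) - ?U N"
      by (simp only: Suc.IH) simp
    also have "\<dots> = - ?U (Suc N)"
      unfolding 1 2 3 4 fps_quot_diff fps_quot_minus[symmetric]
      \<comment> \<open>Up to the factor \<open>p * a\<close>, the first and third numerators
        combine to \<open>(1 + x * r) * (1 - x * (q\<^sup>2 * r))\<close>; subtracting
        \<open>1 + x * r\<close> leaves the new error term.\<close>
      by (rule arg_cong[where f = "\<lambda>f. fps_quot f D"]) (simp add: algebra_simps)
    finally show ?case .
  qed
qed

text \<open>Iterating the shift \<open>k\<close> times collects the factors of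
  \<open>qpoch x\<close>. Every error term is divisible by \<open>q ^ N\<close>, since
  \<open>(N + 1) * (N + 2) \<ge> N\<close>.\<close>

lemma gauss_term_sum_shift_dvd:
  fixes q x :: "'a::comm_ring_1 fps"
  assumes q: "fps_nth q 0 = 0" and x: "fps_nth x 0 = 0"
  shows "q ^ N dvd qpoch x (q\<^sup>2) k * (\<Sum>n\<le>N. gauss_term q x n)
    - (\<Sum>n\<le>N. gauss_term q (x * (q\<^sup>2) ^ k) n)"
proof (induction k)
  case (Suc k)
  let ?y = "x * (q\<^sup>2) ^ k"
  let ?S = "\<lambda>y. \<Sum>n\<le>N. gauss_term q y n"
  have "q ^ N dvd q ^ ((N + 1) * (N + 2))"
    by (rule le_imp_power_dvd) simp
  then have "q ^ N dvd (1 - ?y) * ?S ?y - ?S (?y * q\<^sup>2)"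
    by (subst gauss_term_sum_shift) (simp_all add: q x fps_quot_def)
  moreover have "q ^ N dvd (1 - ?y) * (qpoch x (q\<^sup>2) k * ?S x - ?S ?y)"
    using Suc by simp
  ultimately have "q ^ N dvd (1 - ?y) * (qpoch x (q\<^sup>2) k * ?S x - ?S ?y)
      + ((1 - ?y) * ?S ?y - ?S (?y * q\<^sup>2))"
    by (rule dvd_add[rotated])
  moreover have "?y * q\<^sup>2 = x * (q\<^sup>2) ^ Suc k" by (simp add: mult_ac)
  ultimately show ?case by (simp add: qpoch_Suc algebra_simps)
qed simp

text \<open>After \<open>N\<close> shifts the argument \<open>x * (q\<^sup>2) ^ N\<close> is
  congruent to \<open>0\<close> modulo \<open>q ^ N\<close>, and each summand respects this
  congruence.\<close>

lemma gauss_term_sum_dvd: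
  fixes q x :: "'a::comm_ring_1 fps"
  assumes q: "fps_nth q 0 = 0" and x: "fps_nth x 0 = 0"
  shows "q ^ N dvd qpoch x (q\<^sup>2) N * (\<Sum>n\<le>N. gauss_term q x n) - (\<Sum>n\<le>N. gauss_term q 0 n)"
proof -
  let ?y = "x * (q\<^sup>2) ^ N"
  have "q ^ N dvd (q\<^sup>2) ^ N" by (simp add: dvd_power_same)
  then have y: "q ^ N dvd ?y - 0" "q ^ N dvd - ?y - - 0" by simp_all
  have y0: "fps_nth ?y 0 = 0" "fps_nth (q\<^sup>2) 0 = 0"
    using x q by (simp_all add: power2_eq_square)
  have "q ^ N dvd gauss_term q ?y n - gauss_term q 0 n" for n
    unfolding gauss_term_def
    by (intro dvd_diff_fps_quot dvd_diff_mult qpoch_dvd_diff y)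
       (simp_all add: fps_nth_qpoch_0[OF y0(1)] fps_nth_qpoch_0[OF y0(2)]
         fps_nth_qpoch_0[of 0] del: One_nat_def add_0_right)
  then have "q ^ N dvd (\<Sum>n\<le>N. gauss_term q ?y n) - (\<Sum>n\<le>N. gauss_term q 0 n)"
    by (simp add: dvd_sum flip: sum_subtractf)
  from dvd_add[OF gauss_term_sum_shift_dvd[OF q x, of N N] this] show ?thesis by simp
qed

section \<open>Evaluation of the sum at \<open>x = 0\<close> by way of
  \<open>x = - (q\<^sup>2)\<close>\<close>

text \<open>The numerator product cancels \<open>qpoch (q\<^sup>2) (q\<^sup>2) n\<close>. With T(n)
  = q^(n(n+1)) / (-Q; Q)_n, the remaining summand is T(n) - T(n+1), and T(0) = 1.\<close>

lemma gauss_term_sum_minus_q: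
  fixes q :: "'a::comm_ring_1 fps"
  assumes q: "fps_nth q 0 = 0"
  shows "(\<Sum>n\<le>N. gauss_term q (- (q\<^sup>2)) n)
    = 1 - fps_quot (q ^ ((N + 1) * (N + 2))) (qpoch (- (q\<^sup>2)) (q\<^sup>2) (N + 1))"
proof -
  let ?d = "\<lambda>n. qpoch (- (q\<^sup>2)) (q\<^sup>2) n"
  have [simp]: "fps_nth (qpoch (q\<^sup>2) (q\<^sup>2) n) 0 = 1" "fps_nth (?d n) 0 = 1" for n
    by (simp_all add: fps_nth_qpoch_0 q power2_eq_square)
  have summand: "gauss_term q (- (q\<^sup>2)) n = fps_quot (q ^ (n * (n + 1))) (?d (n + 1))" for n
    using fps_quot_cancel[of "?d (n + 1)" "qpoch (q\<^sup>2) (q\<^sup>2) n" "q ^ (n * (n + 1))"]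
    by (simp add: gauss_term_def mult.commute)
  show ?thesis
  proof (induction N)
    case 0
    have "fps_quot (1 + q\<^sup>2) (1 + q\<^sup>2) = 1"
      by (rule fps_quot_unique[symmetric]) (simp_all add: q power2_eq_square)
    then have "fps_quot 1 (1 + q\<^sup>2) + fps_quot (q\<^sup>2) (1 + q\<^sup>2) = 1"
      by (simp add: fps_quot_add)
    then show ?case
      by (simp add: summand qpoch_Suc eq_diff_eq flip: power2_eq_square)
  next
    case (Suc N)
    define p where "p = q ^ ((N + 1) * (N + 2))"
    \<comment> \<open>The exponent is \<open>N + 2\<close> because the base
      \<open>- (q\<^sup>2)\<close> contributes one more \<open>q\<^sup>2\<close> to the last factor,
      which is \<open>1 + r\<close>.\<close>
    define r where "r = (q\<^sup>2) ^ (N + 2)"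
    have p: "q ^ (Suc N * (Suc N + 1)) = p" "q ^ ((Suc N + 1) * (Suc N + 2)) = p * r"
      unfolding p_def r_def power_mult[symmetric] power_add[symmetric]
      by (rule arg_cong[where f = "power q"], simp)+
    have r0: "fps_nth r 0 = 0" by (simp add: r_def q power2_eq_square)
    have d: "?d (Suc N + 1) = ?d (N + 1) * (1 + r)"
      by (simp add: qpoch_Suc[of _ _ "Suc N"] r_def)
    have "fps_quot p (?d (N + 1)) = fps_quot (p * (1 + r)) (?d (Suc N + 1))"
      unfolding d by (rule fps_quot_cancel[symmetric]) (simp_all add: r0)
    also have "\<dots> = fps_quot p (?d (Suc N + 1)) + fps_quot (p * r) (?d (Suc N + 1))"
      by (simp add: fps_quot_add algebra_simps)
    finally show ?case
      using Suc.IH unfolding sum.atMost_Suc summand p by (simp only: flip: p_def) simp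
  qed
qed

text \<open>At \<open>x = - (q\<^sup>2)\<close> the shift congruence has prefactor
  \<open>?P\<close>, while the sum there is \<open>1 - ?R\<close> with \<open>?R\<close> divisible
  by \<open>q ^ N\<close>.\<close>

lemma gauss_term_0_sum_dvd:
  fixes q :: "'a::comm_ring_1 fps"
  assumes q: "fps_nth q 0 = 0"
  shows "q ^ N dvd qpoch (- (q\<^sup>2)) (q\<^sup>2) N - (\<Sum>n\<le>N. gauss_term q 0 n)"
proof -
  let ?P = "qpoch (- (q\<^sup>2)) (q\<^sup>2) N"
  let ?R = "fps_quot (q ^ ((N + 1) * (N + 2))) (qpoch (- (q\<^sup>2)) (q\<^sup>2) (N + 1))"
  have "q ^ N dvd q ^ ((N + 1) * (N + 2))" by (rule le_imp_power_dvd) simp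
  then have "q ^ N dvd ?P * ?R"
    unfolding fps_quot_def by (intro dvd_mult dvd_mult2)
  moreover have "q ^ N dvd ?P * (\<Sum>n\<le>N. gauss_term q (- (q\<^sup>2)) n) - (\<Sum>n\<le>N. gauss_term q 0 n)"
    by (rule gauss_term_sum_dvd) (simp_all add: q power2_eq_square)
  ultimately have "q ^ N dvd ?P * ?R + (?P * (\<Sum>n\<le>N. gauss_term q (- (q\<^sup>2)) n) - (\<Sum>n\<le>N. gauss_term q 0 n))"
    by (rule dvd_add)
  also have "\<dots> = ?P - (\<Sum>n\<le>N. gauss_term q 0 n)"
    unfolding gauss_term_sum_minus_q[OF q] by (simp only: right_diff_distrib) simp
  finally show ?thesis .
qed

section \<open>Passage to the limit\<close>

lemma gauss_term_sums:
  fixes q x :: "'a::comm_ring_1 fps"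
  assumes q: "fps_nth q 0 = 0" and x: "fps_nth x 0 = 0"
  shows "gauss_term q x sums fps_quot (qpoch_inf (- (q\<^sup>2)) (q\<^sup>2)) (qpoch_inf x (q\<^sup>2))"
    (is "_ sums fps_quot ?A ?B")
  unfolding sums_def_le
proof (rule tendsto_fps_dvdI)
  fix N
  let ?S = "\<lambda>x. \<Sum>n\<le>N. gauss_term q x n"
  let ?a = "qpoch (- (q\<^sup>2)) (q\<^sup>2) N" and ?b = "qpoch x (q\<^sup>2) N"
  have q2: "fps_nth (q\<^sup>2) 0 = 0" "fps_nth (- (q\<^sup>2)) 0 = 0"
    by (simp_all add: q power2_eq_square)
  have B0: "fps_nth ?B 0 = 1" by (rule fps_nth_qpoch_inf_0[OF x q2(1)])
  note X = dvd_trans[OF fps_X_power_dvd_power[OF q]]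
  \<comment> \<open>The four differences encode the chain of congruences from
    \<open>?S x * ?B\<close> through \<open>?b * ?S x\<close>, \<open>?S 0\<close> and
    \<open>?a\<close> to \<open>?A\<close>.\<close>
  have "fps_X ^ N dvd ?S x * (?B - ?b) + (?b * ?S x - ?S 0) - (?a - ?S 0) - (?A - ?a)"
    by (intro dvd_add dvd_diff dvd_mult qpoch_inf_dvd_diff q2 x
        X[OF gauss_term_sum_dvd[OF q x]] X[OF gauss_term_0_sum_dvd[OF q]])
  also have "\<dots> = ?S x * ?B - ?A" by (simp add: algebra_simps)
  also have "\<dots> = (?S x - fps_quot ?A ?B) * ?B"
    by (simp add: left_diff_distrib fps_quot_mult[OF B0])
  finally show "fps_X ^ N dvd ?S x - fps_quot ?A ?B"
    by (rule dvd_mult_unit_cancel[OF B0])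
qed

theorem theorem1p13:
  fixes q t :: "'a::comm_ring_1 poly fps"
  assumes "q = fps_X" and "t = fps_const [:0, 1:]"
  shows "(\<lambda>n. fps_quot (q ^ (n * (n + 1)) * qpoch (- (t * q)) (q\<^sup>2) n)
                       (qpoch (q\<^sup>2) (q\<^sup>2) n * qpoch (t * q) (q\<^sup>2) (n + 1)))
         sums fps_quot (qpoch_inf (- (q\<^sup>2)) (q\<^sup>2)) (qpoch_inf (t * q) (q\<^sup>2))"
proof -
  have "gauss_term q (t * q) sums fps_quot (qpoch_inf (- (q\<^sup>2)) (q\<^sup>2)) (qpoch_inf (t * q) (q\<^sup>2))"
    by (rule gauss_term_sums) (simp_all add: assms(1))
  then show ?thesis by (simp add: gauss_term_def[abs_def])
qed

end
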